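(* 1. For every $m\geq 1$, there exists a set $X_m\subset\mathbb{R}^{2(m+1)}$ of size $3^m-1$ that affinely spans $\mathbb{R}^{2(m+1)}$ and such that each pair of points of $X_m$ is strictly antipodal. Thus, $A'(d)\geq 3^{\lfloor d/2-1\rfloor}-1$ for all $d\geq 4$. 2. For all positive integers $m$ and $s$, there exists a set $Y_{m,s}\subset\mathbb{R}^{2(m+1)}$ of size $n:=s(3^m-1)$ that has at least $$\left(1-\frac{1}{3^m-1}\right)\cdot\frac{n^2}{2}$$ pairs of strictly antipodal points. Thus, $$A'_d(n)\geq\left(1-\frac{1}{3^{\lfloor d/2-1\rfloor}-1}\right)\cdot\frac{n^2}{2}-O(n)$$ for all $d\geq 4$ and $n$.
   Context: Let $X\subset\mathbb{R}^d$ be a set that affinely spans $\mathbb{R}^d$. A pair of points $u,v\in X$ is called strictly antipodal if there exist two distinct parallel hyperplanes $H$ and $H'$ such that $X\cap H=\{u\}$, $X\cap H'=\{v\}$, and $X$ lies in the slab between $H$ and $H'$. $A'(d)$ denotes the maximum size of a set $X\subset\mathbb{R}^d$ having the property that every pair of points of $X$ is strictly antipodal; $A'_d(Y)$ denotes the number of strictly antipodal pairs of a given set $Y$; and $A'_d(n)$ denotes the maximum of $A'_d(Y)$ taken over all $n$-element subsets $Y$ of $\mathbb{R}^d$.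
   Formalization: For m = 1 the claim that X_m affinely spans is dropped, since 2 points cannot affinely span R^4; it is proved for all m ≥ 2, and every other claim is proved for m = 1 as well. *)

theory Defs
  imports "HOL-Analysis.Analysis" "HOL-Library.Extended_Nat"
begin

text \<open>The space \<open>\<real>\<^sup>d\<close> is \<^typ>\<open>real ^ 'n\<close> with \<open>d = CARD('n)\<close>; quantities depending on the
  dimension alone take an argument of type \<^typ>\<open>'n itself\<close>.\<close>

text \<open>Two distinct parallel hyperplanes can be written with one common normal \<open>a\<close>, oriented so
  that the hyperplane through \<open>u\<close> has the smaller offset. The set \<open>X\<close> is not required to affinely
  span the space, since the maxima below range over all (finite) sets.\<close>

definition strictly_antipodal ::
    "(real ^ 'n) set \<Rightarrow> real ^ 'n \<Rightarrow> real ^ 'n \<Rightarrow> bool" where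
  "strictly_antipodal X u v \<longleftrightarrow>
     (\<exists>a b c. a \<noteq> 0 \<and> b < c \<and>
        X \<inter> {x. a \<bullet> x = b} = {u} \<and> X \<inter> {x. a \<bullet> x = c} = {v} \<and>
        X \<subseteq> {x. b \<le> a \<bullet> x \<and> a \<bullet> x \<le> c})"

text \<open>Pairs are unordered. The definition above forces \<open>u\<close> and \<open>v\<close> to be distinct elements
  of \<open>Y\<close>.\<close>

definition num_strictly_antipodal :: "(real ^ 'n) set \<Rightarrow> nat" where
  "num_strictly_antipodal Y = card {{u, v} | u v. strictly_antipodal Y u v}"

text \<open>\<open>A'(d)\<close>. Finite sets suffice: every subset of a set with the property has it too, so
  an infinite one would make the supremum infinite.\<close>

definition max_strictly_antipodal_set :: "'n::finite itself \<Rightarrow> enat" where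
  "max_strictly_antipodal_set _ =
     (SUP X \<in> {X :: (real ^ 'n) set. finite X \<and> pairwise (strictly_antipodal X) X}. enat (card X))"

text \<open>\<open>A'\<^sub>d(n)\<close>. The maximum is over a nonempty set of numbers bounded by \<open>n choose 2\<close>.\<close>

definition max_num_strictly_antipodal :: "'n::finite itself \<Rightarrow> nat \<Rightarrow> nat" where
  "max_num_strictly_antipodal _ n =
     Max {num_strictly_antipodal Y | Y :: (real ^ 'n) set. finite Y \<and> card Y = n}"

text \<open>For \<open>m = 1\<close> a set of \<open>3 ^ m - 1\<close> points cannot affinely span a space of dimension
  \<open>2 * (m + 1)\<close>; the spanning claim can therefore only be made for \<open>m \<ge> 2\<close>.\<close>

lemma two_points_not_spanning:
  fixes X :: "(real ^ 'n) set"
  assumes "CARD('n) = 2 * (1 + 1)" "card X = 3 ^ 1 - 1"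
  shows "affine hull X \<noteq> UNIV"
proof
  assume "affine hull X = UNIV"
  then have "aff_dim X = int (CARD('n))"
    by (metis DIM_cart DIM_real aff_dim_UNIV aff_dim_affine_hull mult.right_neutral)
  moreover have "aff_dim X \<le> int (card X) - 1"
    using assms(2) by (intro aff_dim_le_card) (simp add: card_ge_0_finite)
  ultimately show False using assms by simp
qed

end

theory Submission
  imports Defs
begin

text \<open>Let \<open>N = 3 ^ m - 1\<close> and let \<open>\<Phi>\<close> be the curve with coordinates \<open>cos (3 ^ k * t)\<close>,
  \<open>sin (3 ^ k * t)\<close> for \<open>k \<le> m\<close>, which satisfies \<open>\<Phi> (t + pi) = - \<Phi> t\<close>. For
  \<open>x = cos \<alpha> > 1 / 2\<close>, the odd cubic \<open>3 * x\<^sup>2 * y - y ^ 3\<close> attains its maximum on \<open>[-1, 1]\<close>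
  only at \<open>y = x\<close>; with \<open>y = cos (3 ^ i * t - c)\<close> it is a linear functional of \<open>\<Phi> t\<close> (frequencies
  \<open>3 ^ i\<close> and \<open>3 ^ (i + 1)\<close>). It certifies that \<open>\<Phi> u\<close> and \<open>\<Phi> v\<close> are strictly antipodal as soon as
  \<open>3 ^ i * u\<close> is within \<open>2 * pi / 3\<close> of \<open>3 ^ i * v + pi\<close> modulo \<open>2 * pi\<close>, and multiplication by \<open>3 ^ i\<close>
  separates the parameters modulo \<open>pi\<close>. For distinct parameters in \<open>{pi * j / N | j < N}\<close> some \<open>i < m\<close>
  achieves this, since repeated tripling must carry the difference out of \<open>[- pi / 3, pi / 3]\<close>, and
  \<open>N\<close> is prime to 3. Both conditions survive small perturbations, so each parameter can be replaced by
  a cluster of \<open>s\<close> parameters. The points span affinely by a Vandermonde argument: the nodes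
  \<open>cis (pi * q / N)\<close> with \<open>q \<in> {0} \<union> {\<plusminus> 3 ^ k | k \<le> m}\<close> are distinct when \<open>m \<ge> 2\<close>.\<close>

section \<open>Tools: Vandermonde systems and an extremal cubic\<close>

text \<open>Combining the vanishing moments with the coefficients of \<open>p\<close>, which has
  degree below \<open>card I\<close> and vanishes at every node except \<open>z i\<close>, leaves
  only the term \<open>c i * poly p (z i)\<close>.\<close>

lemma vandermonde_kernel_trivial:
  fixes z :: "'i \<Rightarrow> 'a::field"
  assumes "finite I" "inj_on z I" "i \<in> I"
    and vanish: "\<And>j. j < card I \<Longrightarrow> (\<Sum>i\<in>I. c i * z i ^ j) = 0"
  shows "c i = 0"
proof -
  define p where "p = (\<Prod>k\<in>I - {i}. [:- z k, 1:])"
  have "degree p \<le> (\<Sum>k\<in>I - {i}. degree [:- z k, 1:])"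
    unfolding p_def using degree_prod_sum_le[of "I - {i}" "\<lambda>k. [:- z k, 1:]"] assms(1) by (simp add: comp_def)
  also have "\<dots> = card (I - {i})" by simp
  also have "\<dots> < card I" using assms(1,3) by (rule card_Diff1_less)
  finally have deg: "degree p < card I" .
  have "(\<Sum>k\<in>I. c k * poly p (z k)) = (\<Sum>k\<in>I. \<Sum>j\<le>degree p. coeff p j * (c k * z k ^ j))"
    by (simp add: poly_altdef sum_distrib_left mult_ac)
  also have "\<dots> = (\<Sum>j\<le>degree p. coeff p j * (\<Sum>k\<in>I. c k * z k ^ j))"
    by (subst sum.swap) (simp add: sum_distrib_left)
  also have "\<dots> = 0"
    using vanish deg by simp
  finally have "(\<Sum>k\<in>I. c k * poly p (z k)) = 0" .
  moreover have "poly p (z k) = 0" if "k \<in> I - {i}" for k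
    using that assms(1) by (auto simp: p_def poly_prod)
  then have "(\<Sum>k\<in>I. c k * poly p (z k)) = c i * poly p (z i)"
    using assms(1,3) by (simp add: sum.remove)
  moreover have "poly p (z i) \<noteq> 0"
    using assms(1-3) by (auto simp: p_def poly_prod inj_on_def)
  ultimately show ?thesis by simp
qed

text \<open>The distance to each extreme value is a square times a linear factor, and that factor is
  positive because \<open>\<bar>y\<bar> \<le> 1 < 2 * x\<close>.\<close>

lemma cubic_bound:
  fixes x y :: real
  assumes "1/2 < x" "\<bar>y\<bar> \<le> 1"
  shows "\<bar>3 * x\<^sup>2 * y - y ^ 3\<bar> \<le> 2 * x ^ 3"
    and "3 * x\<^sup>2 * y - y ^ 3 = 2 * x ^ 3 \<longleftrightarrow> y = x"
    and "3 * x\<^sup>2 * y - y ^ 3 = - (2 * x ^ 3) \<longleftrightarrow> y = - x"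
proof -
  have upper: "2 * x ^ 3 - (3 * x\<^sup>2 * y - y ^ 3) = (y - x)\<^sup>2 * (2 * x + y)"
    and lower: "2 * x ^ 3 + (3 * x\<^sup>2 * y - y ^ 3) = (y + x)\<^sup>2 * (2 * x - y)"
    by (simp_all add: algebra_simps power2_eq_square power3_eq_cube)
  have pos: "2 * x + y > 0" "2 * x - y > 0" using assms by auto
  have "2 * x ^ 3 - (3 * x\<^sup>2 * y - y ^ 3) \<ge> 0" "2 * x ^ 3 + (3 * x\<^sup>2 * y - y ^ 3) \<ge> 0"
    unfolding upper lower using pos by simp_all
  then show "\<bar>3 * x\<^sup>2 * y - y ^ 3\<bar> \<le> 2 * x ^ 3" by linarith
  have "3 * x\<^sup>2 * y - y ^ 3 = 2 * x ^ 3 \<longleftrightarrow> (y - x)\<^sup>2 * (2 * x + y) = 0"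
    unfolding upper[symmetric] by linarith
  then show "3 * x\<^sup>2 * y - y ^ 3 = 2 * x ^ 3 \<longleftrightarrow> y = x" using pos by auto
  have "3 * x\<^sup>2 * y - y ^ 3 = - (2 * x ^ 3) \<longleftrightarrow> (y + x)\<^sup>2 * (2 * x - y) = 0"
    unfolding lower[symmetric] by linarith
  then show "3 * x\<^sup>2 * y - y ^ 3 = - (2 * x ^ 3) \<longleftrightarrow> y = - x" using pos by auto
qed

section \<open>Antipodal pairs on a lacunary trigonometric curve\<close>

text \<open>The map \<open>h\<close> selects the coordinates used; all others stay 0, so the curve
  also sits in spaces of dimension above \<open>2 * (m + 1)\<close>.\<close>

definition curve :: "(nat \<Rightarrow> 'n::finite) \<Rightarrow> nat \<Rightarrow> real \<Rightarrow> real ^ 'n" where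
  "curve h m t = (\<Sum>k\<le>m. cos (3 ^ k * t) *\<^sub>R axis (h (2 * k)) 1
                        + sin (3 ^ k * t) *\<^sub>R axis (h (2 * k + 1)) 1)"

lemma curve_nth:
  assumes inj: "inj_on h {..<2 * (m + 1)}" and "k \<le> m"
  shows "curve h m t $ h (2 * k) = cos (3 ^ k * t)"
    and "curve h m t $ h (Suc (2 * k)) = sin (3 ^ k * t)"
proof -
  have inj_h: "a = b" if "h a = h b" "a < 2 * (m + 1)" "b < 2 * (m + 1)" for a b
    using inj that by (auto simp: inj_on_def)
  have eq: "h (2 * k) = h (2 * j) \<longleftrightarrow> j = k" "h (Suc (2 * k)) = h (Suc (2 * j)) \<longleftrightarrow> j = k"
    "h (2 * k) \<noteq> h (Suc (2 * j))" "h (Suc (2 * k)) \<noteq> h (2 * j)" if "j \<le> m" for j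
    using that \<open>k \<le> m\<close> by (auto dest!: inj_h) presburger+
  have "curve h m t $ h (2 * k) = (\<Sum>j\<le>m. if j = k then cos (3 ^ j * t) else 0)"
    unfolding curve_def sum_component by (intro sum.cong) (auto simp: axis_def eq)
  then show "curve h m t $ h (2 * k) = cos (3 ^ k * t)" using \<open>k \<le> m\<close> by simp
  have "curve h m t $ h (Suc (2 * k)) = (\<Sum>j\<le>m. if j = k then sin (3 ^ j * t) else 0)"
    unfolding curve_def sum_component by (intro sum.cong) (auto simp: axis_def eq)
  then show "curve h m t $ h (Suc (2 * k)) = sin (3 ^ k * t)" using \<open>k \<le> m\<close> by simp
qed

text \<open>The triple-angle formula turns the cubic into a combination of \<open>cos y\<close> and
  \<open>cos (3 * y)\<close>, and the addition formulas absorb the shift \<open>c\<close>. Frequency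
  \<open>3 ^ Suc i\<close> must occur in the curve, hence \<open>i < m\<close>.\<close>

lemma cubic_functional:
  fixes h :: "nat \<Rightarrow> 'n::finite"
  assumes inj: "inj_on h {..<2 * (m + 1)}" and "i < m"
  obtains a :: "real ^ 'n"
  where "\<And>t. a \<bullet> curve h m t = 3 * x\<^sup>2 * cos (3 ^ i * t - c) - cos (3 ^ i * t - c) ^ 3"
proof
  define r where "r = 3 * x\<^sup>2 - 3 / 4"
  fix t
  have cubic: "cos y ^ 3 = cos (3 * y) / 4 + 3 / 4 * cos y" for y :: real
    using cos_treble_cos[of y] by (simp add: field_simps)
  have three: "3 * (3 ^ i * t - c) = 3 ^ Suc i * t - 3 * c" by simp
  have "(axis (h (2 * i)) (r * cos c) + axis (h (Suc (2 * i))) (r * sin c)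
       - axis (h (2 * Suc i)) (cos (3 * c) / 4) - axis (h (Suc (2 * Suc i))) (sin (3 * c) / 4))
       \<bullet> curve h m t
     = r * cos (3 ^ i * t - c) - cos (3 ^ Suc i * t - 3 * c) / 4"
    using \<open>i < m\<close>
    by (simp only: inner_add_left inner_diff_left inner_axis' curve_nth[OF inj] Suc_leI less_imp_le
        cos_diff inner_real_def) (simp add: field_simps)
  also have "\<dots> = 3 * x\<^sup>2 * cos (3 ^ i * t - c) - cos (3 ^ i * t - c) ^ 3"
    unfolding cubic three r_def by (simp add: algebra_simps)
  finally show "(axis (h (2 * i)) (r * cos c) + axis (h (Suc (2 * i))) (r * sin c)
       - axis (h (2 * Suc i)) (cos (3 * c) / 4) - axis (h (Suc (2 * Suc i))) (sin (3 * c) / 4))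
       \<bullet> curve h m t = 3 * x\<^sup>2 * cos (3 ^ i * t - c) - cos (3 ^ i * t - c) ^ 3" .
qed

text \<open>The shift \<open>c\<close> is the midpoint of \<open>3 ^ i * u\<close> and
  \<open>w\<close>, and \<open>w\<close> differs from \<open>3 ^ i * v\<close> by an odd multiple of
  pi. So \<open>g u = x\<close> and \<open>g v = - x\<close>, where the cubic is extremal;
  \<open>close\<close> says \<open>\<bar>\<alpha>\<bar> < pi / 3\<close>, which gives
  \<open>x > 1 / 2\<close>.\<close>

lemma strictly_antipodal_curve:
  fixes h :: "nat \<Rightarrow> 'n::finite" and q :: int
  assumes inj: "inj_on h {..<2 * (m + 1)}" and "i < m" and "u \<in> T" "v \<in> T" and "odd q"
    and close: "\<bar>3 ^ i * (u - v) - pi * q\<bar> < 2 * pi / 3"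
    and sep: "\<And>t t' z. \<lbrakk>t \<in> T; t' \<in> T; 3 ^ i * (t - t') = pi * of_int z\<rbrakk> \<Longrightarrow> t = t'"
  shows "strictly_antipodal (curve h m ` T) (curve h m u) (curve h m v)"
proof -
  define w where "w = 3 ^ i * v + pi * q"
  define \<alpha> where "\<alpha> = (3 ^ i * u - w) / 2"
  define c where "c = (3 ^ i * u + w) / 2"
  define x where "x = cos \<alpha>"
  define g where "g = (\<lambda>t. cos (3 ^ i * t - c))"
  obtain a :: "real ^ 'n" where a: "\<And>t. a \<bullet> curve h m t = 3 * x\<^sup>2 * g t - g t ^ 3"
    using cubic_functional[OF inj \<open>i < m\<close>, of x c] unfolding g_def by blast
  obtain p where p: "q = 2 * p + 1" using \<open>odd q\<close> by (auto elim: oddE)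
  have "\<bar>\<alpha>\<bar> < pi / 3"
    using close by (simp add: \<alpha>_def w_def algebra_simps)
  then have "cos (pi / 3) < cos \<bar>\<alpha>\<bar>"
    by (intro cos_monotone_0_pi) auto
  then have x: "1 / 2 < x" by (simp add: x_def cos_60)
  have g: "\<bar>g t\<bar> \<le> 1" for t by (simp add: g_def)
  have sep0: "z = 0" if "t \<in> T" "t' \<in> T" "3 ^ i * (t - t') = pi * of_int z" for t t' z
    using sep[OF that] that(3) by simp
  have top: "t = u" if "t \<in> T" "g t = x" for t
  proof -
    from that(2) obtain n where "n \<in> \<int>"
      and n: "3 ^ i * t - c = \<alpha> + 2 * n * pi \<or> 3 ^ i * t - c = - \<alpha> + 2 * n * pi"
      unfolding g_def x_def cos_eq by blast
    then obtain z where z: "n = of_int z" by (auto elim: Ints_cases)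
    from n show ?thesis
    proof
      assume "3 ^ i * t - c = \<alpha> + 2 * n * pi"
      then have "3 ^ i * (t - u) = pi * of_int (2 * z)"
        by (simp add: \<alpha>_def c_def z field_simps)
      with sep \<open>t \<in> T\<close> \<open>u \<in> T\<close> show ?thesis by blast
    next
      \<comment> \<open>The reflected solution puts \<open>3 ^ i * t\<close> an odd multiple of pi
        away from \<open>3 ^ i * v\<close>; \<open>sep0\<close> makes that multiple 0, against
        parity.\<close>
      assume "3 ^ i * t - c = - \<alpha> + 2 * n * pi"
      then have "3 ^ i * (t - v) = pi * of_int (2 * p + 1 + 2 * z)"
        by (simp add: \<alpha>_def c_def w_def z p field_simps)
      from sep0[OF \<open>t \<in> T\<close> \<open>v \<in> T\<close> this] have False by presburger
      then show ?thesis ..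
    qed
  qed
  \<comment> \<open>The roles swap: now the branch through \<open>u\<close> fails by parity and the
    branch through \<open>v\<close> survives.\<close>
  have bot: "t = v" if "t \<in> T" "g t = - x" for t
  proof -
    from that(2) have "cos (3 ^ i * t - c) = cos (\<alpha> + pi)"
      by (simp add: g_def x_def)
    then obtain n where "n \<in> \<int>"
      and n: "3 ^ i * t - c = \<alpha> + pi + 2 * n * pi \<or> 3 ^ i * t - c = - (\<alpha> + pi) + 2 * n * pi"
      unfolding cos_eq by blast
    then obtain z where z: "n = of_int z" by (auto elim: Ints_cases)
    from n show ?thesis
    proof
      assume "3 ^ i * t - c = \<alpha> + pi + 2 * n * pi"
      then have "3 ^ i * (t - u) = pi * of_int (1 + 2 * z)"
        by (simp add: \<alpha>_def c_def z field_simps)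
      from sep0[OF \<open>t \<in> T\<close> \<open>u \<in> T\<close> this] have False by presburger
      then show ?thesis ..
    next
      assume "3 ^ i * t - c = - (\<alpha> + pi) + 2 * n * pi"
      then have "3 ^ i * (t - v) = pi * of_int (2 * p + 2 * z)"
        by (simp add: \<alpha>_def c_def w_def z p field_simps)
      with sep \<open>t \<in> T\<close> \<open>v \<in> T\<close> show ?thesis by blast
    qed
  qed
  have gu: "g u = x"
    by (simp add: g_def x_def c_def \<alpha>_def field_simps)
  have "3 ^ i * v - c = - \<alpha> - pi * q"
    by (simp add: c_def \<alpha>_def w_def field_simps)
  also have "\<dots> = - (\<alpha> + pi) + 2 * of_int (- p) * pi"
    by (simp add: p algebra_simps)
  finally have "g v = cos (\<alpha> + pi)"
    unfolding g_def cos_eq by (meson Ints_of_int)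
  then have gv: "g v = - x" by (simp add: x_def)
  define M where "M = 2 * x ^ 3"
  have "M > 0" using x by (simp add: M_def)
  have au: "a \<bullet> curve h m u = M" and av: "a \<bullet> curve h m v = - M"
    by (simp_all add: a gu gv M_def power2_eq_square power3_eq_cube)
  have top_iff: "a \<bullet> curve h m t = M \<longleftrightarrow> t = u" if "t \<in> T" for t
    using top[OF that] au cubic_bound(2)[OF x g] unfolding a M_def by blast
  have bot_iff: "a \<bullet> curve h m t = - M \<longleftrightarrow> t = v" if "t \<in> T" for t
    using bot[OF that] av cubic_bound(3)[OF x g] unfolding a M_def by blast
  have bound: "\<bar>a \<bullet> curve h m t\<bar> \<le> M" for t
    unfolding a M_def by (rule cubic_bound(1)[OF x g])
  \<comment> \<open>The functional \<open>a\<close> is largest at \<open>u\<close>, but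
    \<open>strictly_antipodal\<close> puts \<open>u\<close> on the lower hyperplane; the normal is
    therefore \<open>- a\<close>.\<close>
  have neg: "- a \<bullet> y = - M \<longleftrightarrow> a \<bullet> y = M" "- a \<bullet> y = M \<longleftrightarrow> a \<bullet> y = - M" for y
    by (auto simp: minus_equation_iff)
  show ?thesis unfolding strictly_antipodal_def
  proof (intro exI conjI)
    show "- a \<noteq> 0" using au \<open>M > 0\<close> by auto
    show "- M < M" using \<open>M > 0\<close> by simp
    show "curve h m ` T \<inter> {y. - a \<bullet> y = - M} = {curve h m u}"
      unfolding neg using \<open>u \<in> T\<close> top_iff by blast
    show "curve h m ` T \<inter> {y. - a \<bullet> y = M} = {curve h m v}"
      unfolding neg using \<open>v \<in> T\<close> bot_iff by blast
    show "curve h m ` T \<subseteq> {y. - M \<le> - a \<bullet> y \<and> - a \<bullet> y \<le> M}"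
      using bound by (auto simp: abs_le_iff minus_le_iff)
  qed
qed

section \<open>Clusters of parameters\<close>

text \<open>The pair \<open>(j, l)\<close> is the \<open>l\<close>-th parameter of the cluster at \<open>pi * j / N\<close>. The step within
  a cluster is so small that offsets stay below a third of the spacing \<open>pi / N\<close> even after
  multiplication by \<open>3 ^ m\<close>.\<close>

definition angle :: "nat \<Rightarrow> nat \<Rightarrow> nat \<times> nat \<Rightarrow> real" where
  "angle m S a = pi / (3 ^ m - 1) * (real (fst a) + real (snd a) / (3 ^ (m + 1) * real S))"

text \<open>Clearing denominators gives an equation of integers. Modulo \<open>D\<close> it forces
  \<open>l = l'\<close>, since \<open>3 ^ i * \<bar>l - l'\<bar> < D\<close>; then \<open>N\<close>
  divides \<open>3 ^ i * (j - j')\<close>, hence \<open>j - j'\<close>, which is smaller than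
  \<open>N\<close> in absolute value.\<close>

lemma angle_separated:
  fixes z :: int
  assumes a: "a \<in> {..<3 ^ m - 1} \<times> {..<S}" and b: "b \<in> {..<3 ^ m - 1} \<times> {..<S}" and "i \<le> m"
    and eq: "3 ^ i * (angle m S a - angle m S b) = pi * of_int z"
  shows "a = b"
proof -
  obtain j l j' l' where ab: "a = (j, l)" "b = (j', l')" by fastforce
  define N :: int where "N = 3 ^ m - 1"
  define D :: int where "D = 3 ^ (m + 1) * int S"
  have jl: "j < 3 ^ m - 1" "j' < 3 ^ m - 1" "l < S" "l' < S" using a b by (auto simp: ab)
  have N_int: "N = int (3 ^ m - 1)" by (simp add: N_def of_nat_diff)
  have N: "int j < N" "int j' < N" unfolding N_int of_nat_less_iff using jl by simp_all
  then have "N > 0" by simp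
  then have "m \<noteq> 0" by (intro notI) (simp add: N_def)
  have "D > 0" using jl by (simp add: D_def)
  have angle: "angle m S (p, q) = pi / of_int N * (real p + real q / of_int D)" for p q
    by (simp add: angle_def N_def D_def)
  have "3 ^ i * ((real j - real j') * of_int D + (real l - real l')) = of_int (N * z * D)"
  proof -
    have "pi * (3 ^ i * ((real j - real j') * of_int D + (real l - real l'))) =
        3 ^ i * (angle m S a - angle m S b) * of_int N * of_int D"
      using \<open>N > 0\<close> \<open>D > 0\<close> by (simp add: ab angle field_simps)
    also have "\<dots> = pi * of_int (N * z * D)" unfolding eq by simp
    finally show ?thesis by simp
  qed
  then have "of_int (3 ^ i * ((int j - int j') * D + (int l - int l'))) = (of_int (N * z * D) :: real)"
    by simp
  then have int_eq: "3 ^ i * ((int j - int j') * D + (int l - int l')) = N * z * D"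
    unfolding of_int_eq_iff .
  have "D dvd 3 ^ i * (int l - int l')"
  proof -
    have "3 ^ i * (int l - int l') = D * (N * z - 3 ^ i * (int j - int j'))"
      using int_eq by (simp add: algebra_simps)
    then show ?thesis by simp
  qed
  moreover have "\<bar>3 ^ i * (int l - int l')\<bar> < \<bar>D\<bar>"
  proof -
    have "\<bar>3 ^ i * (int l - int l')\<bar> \<le> 3 ^ m * \<bar>int l - int l'\<bar>"
      using \<open>i \<le> m\<close> by (simp add: abs_mult mult_right_mono power_increasing)
    also have "\<dots> < 3 ^ m * int S" using jl by simp
    also have "\<dots> \<le> D" by (simp add: D_def)
    finally show ?thesis by simp
  qed
  ultimately have "l = l'" using dvd_imp_le_int[of "3 ^ i * (int l - int l')" D] by fastforce
  then have "3 ^ i * (int j - int j') * D = N * z * D" using int_eq by (simp add: algebra_simps)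
  then have "N dvd 3 ^ i * (int j - int j')" using \<open>D > 0\<close> by simp
  moreover have "coprime N (3 ^ i)"
  proof -
    \<comment> \<open>Consecutive integers are coprime, and \<open>m \<noteq> 0\<close> passes from
      \<open>3 ^ m\<close> to 3.\<close>
    have "coprime (3 ^ m - 1 :: int) (3 ^ m)" by (rule coprime_diff_one_left)
    then show ?thesis using \<open>m \<noteq> 0\<close> by (simp add: N_def)
  qed
  ultimately have "N dvd int j - int j'" by (simp add: coprime_dvd_mult_right_iff)
  then have "j = j'" using N dvd_imp_le_int[of "int j - int j'" N] by force
  with \<open>l = l'\<close> show ?thesis by (simp add: ab)
qed

text \<open>Take the least \<open>i\<close> meeting the lower bound; minimality gives the upper
  bound, and for \<open>i = 0\<close> it is the hypothesis on \<open>d\<close>.\<close>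

lemma power3_window:
  fixes d :: nat
  assumes "0 < d" "d < 3 ^ m"
  obtains i where "i < m" "3 ^ m \<le> 3 ^ Suc i * d" "3 ^ i * d < 3 ^ m"
proof -
  define i where "i = (LEAST i. 3 ^ m \<le> 3 ^ Suc i * d)"
  have "m \<noteq> 0" using assms by (intro notI) simp
  then have P: "3 ^ m \<le> 3 ^ Suc (m - 1) * d" using assms by simp
  have "3 ^ m \<le> 3 ^ Suc i * d" unfolding i_def by (rule LeastI[where P = "\<lambda>i. 3 ^ m \<le> 3 ^ Suc i * d", OF P])
  moreover have "i \<le> m - 1" unfolding i_def by (rule Least_le[where P = "\<lambda>i. 3 ^ m \<le> 3 ^ Suc i * d", OF P])
  moreover have "3 ^ i * d < 3 ^ m"
  proof (cases i)
    case (Suc k)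
    then have "\<not> 3 ^ m \<le> 3 ^ Suc k * d" using not_less_Least[of k "\<lambda>i. 3 ^ m \<le> 3 ^ Suc i * d"] unfolding i_def by auto
    then show ?thesis by (simp add: Suc)
  qed (use assms in simp)
  ultimately show thesis using that[of i] \<open>m \<noteq> 0\<close> by auto
qed

text \<open>For \<open>d = \<bar>j - j'\<bar>\<close> the window gives
  \<open>(N + 1) / 3 \<le> 3 ^ i * d \<le> N\<close>, so \<open>3 ^ i * d\<close> is within
  \<open>(2 * N - 1) / 3\<close> of \<open>N\<close>. The missing \<open>1 / 3\<close> absorbs the
  offsets inside the clusters, and scaling by \<open>pi / N\<close> yields
  \<open>2 * pi / 3\<close>. The odd multiple is the sign of \<open>j - j'\<close>.\<close>

lemma angle_close:
  assumes a: "a \<in> {..<3 ^ m - 1} \<times> {..<S}" and b: "b \<in> {..<3 ^ m - 1} \<times> {..<S}"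
    and "fst a \<noteq> fst b"
  obtains i and q :: int
  where "i < m" "odd q" "\<bar>3 ^ i * (angle m S a - angle m S b) - pi * q\<bar> < 2 * pi / 3"
proof -
  obtain j l j' l' where ab: "a = (j, l)" "b = (j', l')" by fastforce
  define N :: real where "N = 3 ^ m - 1"
  define D :: real where "D = 3 ^ (m + 1) * real S"
  define d where "d = nat \<bar>int j - int j'\<bar>"
  define q where "q = sgn (int j - int j')"
  have jl: "j < 3 ^ m - 1" "j' < 3 ^ m - 1" "l < S" "l' < S" "j \<noteq> j'" using assms by (auto simp: ab)
  have "d \<le> j \<or> d \<le> j'" by (auto simp: d_def)
  then have "d < 3 ^ m" using jl(1,2) by linarith
  have "0 < d" using jl by (simp add: d_def)
  then obtain i where i: "i < m" "3 ^ m \<le> 3 ^ Suc i * d" "3 ^ i * d < 3 ^ m"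
    using \<open>d < 3 ^ m\<close> by (rule power3_window)
  have "m \<noteq> 0" using i by simp
  then have "(3::real) ^ 1 \<le> 3 ^ m" by (intro power_increasing) auto
  then have "N > 0" by (simp add: N_def)
  have "D > 0" using jl by (simp add: D_def)
  have q: "\<bar>q\<bar> = 1" "odd q" using jl by (auto simp: q_def sgn_if)
  have jq: "real j - real j' = q * real d" by (auto simp: q_def d_def sgn_if)
  \<comment> \<open>Integrality sharpens the strict upper bound by one, which turns
    \<open>3 ^ m\<close> into \<open>N\<close>.\<close>
  have "real (3 ^ m) \<le> real (3 ^ Suc i * d)" "real (3 ^ i * d + 1) \<le> real (3 ^ m)"
    using i(2,3) by (simp_all only: of_nat_le_iff)
  then have d: "N + 1 \<le> 3 * (3 ^ i * real d)" "3 ^ i * real d \<le> N" by (simp_all add: N_def)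
  have small: "\<bar>3 ^ i * ((real l - real l') / D)\<bar> < 1 / 3"
  proof -
    have "3 ^ i * \<bar>real l - real l'\<bar> < 3 ^ m * real S"
      using jl i(1) by (intro mult_le_less_imp_less) (auto simp: power_increasing)
    also have "\<dots> = D / 3" by (simp add: D_def)
    finally show ?thesis using \<open>D > 0\<close> by (simp add: abs_mult pos_divide_less_eq)
  qed
  have "\<bar>3 ^ i * (q * real d) - N * q\<bar> = \<bar>real_of_int q\<bar> * \<bar>3 ^ i * real d - N\<bar>"
    unfolding abs_mult[symmetric] by (simp add: algebra_simps)
  also have "\<bar>real_of_int q\<bar> = 1" using q(1) by linarith
  finally have q_bound: "\<bar>3 ^ i * (q * real d) - N * q\<bar> \<le> (2 * N - 1) / 3" using d by simp
  have add_bound: "\<bar>x + y\<bar> < 2 * N / 3" if "\<bar>x\<bar> \<le> (2 * N - 1) / 3" "\<bar>y\<bar> < 1 / 3" for x y :: real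
    using that by argo
  have bound: "\<bar>3 ^ i * (q * real d) - N * q + 3 ^ i * ((real l - real l') / D)\<bar> < 2 * N / 3"
    by (rule add_bound[OF q_bound small])
  have "pi / N > 0" using \<open>N > 0\<close> by simp
  have "3 ^ i * (angle m S a - angle m S b) - pi * q =
      pi / N * (3 ^ i * (q * real d) - N * q + 3 ^ i * ((real l - real l') / D))"
    unfolding jq[symmetric] angle_def ab N_def[symmetric] D_def[symmetric]
    using \<open>N > 0\<close> \<open>D > 0\<close> by (simp add: field_simps)
  also have "\<bar>\<dots>\<bar> < pi / N * (2 * N / 3)"
    using mult_strict_left_mono[OF bound \<open>pi / N > 0\<close>] \<open>pi / N > 0\<close>
    by (simp only: abs_mult abs_of_pos)
  also have "\<dots> = 2 * pi / 3" using \<open>N > 0\<close> by simp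
  finally show thesis using that i(1) q(2) by blast
qed

text \<open>Allowing any subset \<open>A\<close> of the grid admits cardinalities that are not
  multiples of \<open>3 ^ m - 1\<close>.\<close>

lemma clustered_configuration:
  fixes h :: "nat \<Rightarrow> 'n::finite"
  assumes inj: "inj_on h {..<2 * (m + 1)}" and A: "A \<subseteq> {..<3 ^ m - 1} \<times> {..<S}"
  shows "inj_on (\<lambda>a. curve h m (angle m S a)) A"
    and "\<And>a b. \<lbrakk>a \<in> A; b \<in> A; fst a \<noteq> fst b\<rbrakk> \<Longrightarrow> strictly_antipodal
       ((\<lambda>a. curve h m (angle m S a)) ` A) (curve h m (angle m S a)) (curve h m (angle m S b))"
proof -
  show "inj_on (\<lambda>a. curve h m (angle m S a)) A"
  proof (rule inj_onI)
    fix a b assume "a \<in> A" "b \<in> A" and eq: "curve h m (angle m S a) = curve h m (angle m S b)"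
    \<comment> \<open>The coordinates of frequency 1 determine the angle modulo
      \<open>2 * pi\<close>.\<close>
    have "sin (angle m S a) = sin (angle m S b)" "cos (angle m S a) = cos (angle m S b)"
      using arg_cong[OF eq, of "\<lambda>x. x $ h (2 * 0)"] arg_cong[OF eq, of "\<lambda>x. x $ h (Suc (2 * 0))"]
      by (simp_all only: curve_nth[OF inj]) simp_all
    then obtain z :: int where "angle m S a = angle m S b + 2 * pi * z"
      using sin_cos_eq_iff by blast
    then have "3 ^ 0 * (angle m S a - angle m S b) = pi * of_int (2 * z)" by simp
    then show "a = b"
      using angle_separated[of a m S b 0 "2 * z"] A \<open>a \<in> A\<close> \<open>b \<in> A\<close> by blast
  qed
next
  fix a b assume ab: "a \<in> A" "b \<in> A" "fst a \<noteq> fst b"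
  then have AB: "a \<in> {..<3 ^ m - 1} \<times> {..<S}" "b \<in> {..<3 ^ m - 1} \<times> {..<S}"
    using A by blast+
  obtain i and q :: int where i: "i < m" "odd q"
    "\<bar>3 ^ i * (angle m S a - angle m S b) - pi * q\<bar> < 2 * pi / 3"
    using AB ab(3) by (rule angle_close)
  have "strictly_antipodal (curve h m ` (angle m S ` A)) (curve h m (angle m S a)) (curve h m (angle m S b))"
  proof (rule strictly_antipodal_curve[OF inj i(1) _ _ i(2,3)])
    fix t t' and z :: int
    assume t: "t \<in> angle m S ` A" "t' \<in> angle m S ` A" and eq: "3 ^ i * (t - t') = pi * of_int z"
    from t obtain a b where "a \<in> A" "b \<in> A" and ab: "t = angle m S a" "t' = angle m S b" by blast
    then have "a = b" using angle_separated[of a m S b i z] A eq i(1) by auto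
    then show "t = t'" by (simp add: ab)
  qed (use ab in auto)
  then show "strictly_antipodal
       ((\<lambda>a. curve h m (angle m S a)) ` A) (curve h m (angle m S a)) (curve h m (angle m S b))"
    by (simp add: image_image)
qed

section \<open>Counting pairs across clusters\<close>

lemma strictly_antipodal_pairs_subset:
  "{{u, v} | u v. strictly_antipodal Y u v} \<subseteq> Pow Y"
proof -
  have "u \<in> Y \<and> v \<in> Y" if "strictly_antipodal Y u v" for u v
    using that by (auto simp: strictly_antipodal_def)
  then show ?thesis by blast
qed

text \<open>Only the full grid inside \<open>A\<close> is counted: \<open>N\<close> choose 2 pairs
  of clusters, each contributing \<open>s\<^sup>2\<close> pairs of points.\<close>

lemma num_strictly_antipodal_clusters:
  fixes p :: "nat \<times> nat \<Rightarrow> real ^ 'n"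
  assumes "finite A" and inj: "inj_on p A" and sub: "{..<N} \<times> {..<s} \<subseteq> A"
    and anti: "\<And>a b. \<lbrakk>a \<in> A; b \<in> A; fst a \<noteq> fst b\<rbrakk> \<Longrightarrow> strictly_antipodal (p ` A) (p a) (p b)"
  shows "(real s)\<^sup>2 * (real N * (real N - 1) / 2) \<le> real (num_strictly_antipodal (p ` A))"
proof -
  define B where "B = (SIGMA k:{..<N}. {..<k}) \<times> ({..<s} \<times> {..<s})"
  define g where "g = (\<lambda>((k, j), (l, l')). {p (k, l), p (j, l')})"
  have p_eq: "p a = p b \<longleftrightarrow> a = b" if "a \<in> {..<N} \<times> {..<s}" "b \<in> {..<N} \<times> {..<s}" for a b
    using inj sub that by (auto simp: inj_on_def)
  have "inj_on g B"
    \<comment> \<open>Since \<open>j < k\<close> in \<open>B\<close>, the swapped reading of a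
      doubleton is impossible.\<close>
    by (rule inj_onI) (auto simp: B_def g_def doubleton_eq_iff p_eq)
  have "real (\<Sum>k<N. k) = real N * (real N - 1) / 2"
    by (induction N) (simp_all add: field_simps)
  then have "(real s)\<^sup>2 * (real N * (real N - 1) / 2) = real (card B)"
    by (simp add: B_def card_cartesian_product power2_eq_square)
  also have "card B = card (g ` B)" using \<open>inj_on g B\<close> by (simp add: card_image)
  also have "\<dots> \<le> num_strictly_antipodal (p ` A)"
    unfolding num_strictly_antipodal_def
  proof (rule card_mono)
    show "finite {{u, v} | u v. strictly_antipodal (p ` A) u v}"
      using strictly_antipodal_pairs_subset by (rule finite_subset) (simp add: \<open>finite A\<close>)
    have "strictly_antipodal (p ` A) (p (k, l)) (p (j, l'))"
      if "k < N" "j < k" "l < s" "l' < s" for k j l l'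
      using that sub by (intro anti) auto
    then show "g ` B \<subseteq> {{u, v} | u v. strictly_antipodal (p ` A) u v}"
      by (fastforce simp: B_def g_def)
  qed
  finally show ?thesis by simp
qed

lemma exists_inj_on_lessThan:
  assumes "k \<le> CARD('n::finite)"
  obtains h :: "nat \<Rightarrow> 'n::finite" where "inj_on h {..<k}"
  using assms card_le_inj[of "{..<k}" "UNIV :: 'n set"] by auto

text \<open>The index set is squeezed between the grids with \<open>s\<close> and
  \<open>Suc s\<close> points per cluster, so every \<open>n\<close> in this range is reached while
  the full \<open>s\<close>-point clusters are kept.\<close>

lemma exists_many_strictly_antipodal_pairs:
  assumes "2 * (m + 1) \<le> CARD('n::finite)" "s * (3 ^ m - 1) \<le> n" "n \<le> Suc s * (3 ^ m - 1)"
  obtains Y :: "(real ^ 'n::finite) set" where "finite Y" "card Y = n"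
    "(real s)\<^sup>2 * ((3 ^ m - 1) * (3 ^ m - 2) / 2) \<le> real (num_strictly_antipodal Y)"
proof -
  obtain h :: "nat \<Rightarrow> 'n" where inj: "inj_on h {..<2 * (m + 1)}"
    using assms(1) by (rule exists_inj_on_lessThan)
  have "\<exists>A. {..<3 ^ m - 1 :: nat} \<times> {..<s} \<subseteq> A \<and> A \<subseteq> {..<3 ^ m - 1} \<times> {..<Suc s} \<and> card A = n"
    using assms(2,3) by (intro exists_subset_between) (auto simp: card_cartesian_product mult.commute)
  then obtain A where A: "{..<3 ^ m - 1 :: nat} \<times> {..<s} \<subseteq> A" "A \<subseteq> {..<3 ^ m - 1} \<times> {..<Suc s}" "card A = n"
    by blast
  note conf = clustered_configuration[OF inj A(2)]
  have "finite A" using A(2) by (rule finite_subset) simp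
  show thesis
  proof
    let ?Y = "(\<lambda>a. curve h m (angle m (Suc s) a)) ` A"
    show "finite ?Y" using \<open>finite A\<close> by simp
    show "card ?Y = n" using conf(1) A(3) by (simp add: card_image)
    show "(real s)\<^sup>2 * ((3 ^ m - 1) * (3 ^ m - 2) / 2) \<le> real (num_strictly_antipodal ?Y)"
      using num_strictly_antipodal_clusters[OF \<open>finite A\<close> conf(1) A(1) conf(2)]
      by (simp add: of_nat_diff)
  qed
qed

section \<open>Affine span of the sampled curve\<close>

text \<open>A hyperplane containing all points is a trigonometric polynomial vanishing at the
  sampled parameters. In exponential form this is a Vandermonde system, whose trivial kernel forces
  the normal to be 0.\<close>

lemma affine_hull_curve:
  fixes h :: "nat \<Rightarrow> 'n::finite"
  assumes inj: "inj_on h {..<2 * (m + 1)}" and dim: "CARD('n) = 2 * (m + 1)" and "m \<ge> 2"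
  shows "affine hull ((\<lambda>j. curve h m (pi / (3 ^ m - 1) * real j)) ` {..<3 ^ m - 1}) = UNIV"
    (is "affine hull ?X = UNIV")
proof (rule ccontr)
  assume "affine hull ?X \<noteq> UNIV"
  then have "aff_dim ?X < DIM(real ^ 'n)"
    by (metis aff_dim_eq_full aff_dim_le_DIM order_le_less)
  then obtain a :: "real ^ 'n" and c where "a \<noteq> 0" and sub: "?X \<subseteq> {x. a \<bullet> x = c}"
    using aff_lowdim_subset_hyperplane by blast
  define N :: int where "N = 3 ^ m - 1"
  \<comment> \<open>Chosen so that \<open>w k * cis \<theta> + cnj (w k) * cis (- \<theta>)\<close>
    is the \<open>k\<close>-th cosine-sine term at angle \<open>\<theta>\<close>.\<close>
  define w where "w = (\<lambda>k. Complex (a $ h (2 * k)) (- a $ h (Suc (2 * k))) / 2)"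
  \<comment> \<open>\<open>None\<close> is the constant term; \<open>Some (k, b)\<close> is the exponential of frequency \<open>\<plusminus> 3 ^ k\<close>.\<close>
  define I where "I = insert None (Some ` ({..m} \<times> (UNIV :: bool set)))"
  define F where "F = case_option 0 (\<lambda>(k, b). if b then 3 ^ k else - (3 ^ k) :: int)"
  define C where "C = case_option (- complex_of_real c) (\<lambda>(k, b). if b then w k else cnj (w k))"
  define z where "z = (\<lambda>x. cis (pi / of_int N * of_int (F x)))"
  have "(3::int) ^ 2 \<le> 3 ^ m" using \<open>m \<ge> 2\<close> by (intro power_increasing) auto
  then have N: "N \<ge> 8" by (simp add: N_def)
  have "finite I" by (simp add: I_def)
  have "card I = 2 * m + 3"
    by (simp add: I_def card_image card_cartesian_product card_insert_if)
  \<comment> \<open>There must be at least as many samples as nodes: 7 against 8 for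
    \<open>m = 2\<close>, but 5 against 2 for \<open>m = 1\<close>.\<close>
  also have "2 * m + 3 \<le> 3 ^ m - 1"
    using \<open>m \<ge> 2\<close> by (induction m rule: dec_induct) simp_all
  finally have card: "card I \<le> 3 ^ m - 1" .
  have "inj_on z I"
  proof (rule inj_onI)
    fix x y assume xy: "x \<in> I" "y \<in> I" and "z x = z y"
    then obtain r :: int where
      "pi / of_int N * of_int (F x) = pi / of_int N * of_int (F y) + 2 * pi * of_int r"
      unfolding z_def cis.ctr complex.inject using sin_cos_eq_iff by metis
    then have "pi * of_int (F x) = pi * of_int (F y + 2 * N * r)"
      using N by (simp add: field_simps)
    then have "of_int (F x) = (of_int (F y + 2 * N * r) :: real)"
      by (simp only: mult_cancel_left) simp
    then have eq: "F x = F y + 2 * N * r"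
      unfolding of_int_eq_iff .
    \<comment> \<open>Nodes coincide only for frequencies congruent modulo \<open>2 * N\<close>. The
      top frequencies \<open>N + 1\<close> and \<open>- (N + 1)\<close> differ by
      \<open>2 * N + 2\<close>, and any other difference is at most
      \<open>4 * (N + 1) / 3 < 2 * N\<close> in absolute value.\<close>
    have F_cases: "3 * \<bar>F v\<bar> \<le> N + 1 \<or> F v = N + 1 \<or> F v = - (N + 1)" if v: "v \<in> I" for v
    proof (cases v)
      case (Some kb)
      then obtain k b where kb: "v = Some (k, b)" by (cases kb) auto
      then have "k \<le> m" using v by (auto simp: I_def)
      then consider "k = m" | "Suc k \<le> m" by linarith
      then show ?thesis
      proof cases
        case 2
        then have "(3::int) ^ Suc k \<le> 3 ^ m" by (intro power_increasing) auto
        then show ?thesis by (simp add: kb F_def N_def)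
      qed (simp add: kb F_def N_def)
    qed (use N in \<open>simp add: F_def\<close>)
    have "r = 0"
    proof (rule ccontr)
      assume "r \<noteq> 0"
      then consider "r = 1" | "r = - 1" | "r \<ge> 2" | "r \<le> - 2" by linarith
      then show False
      proof cases
        case 1
        then have "F x = F y + 2 * N" using eq by simp
        then show ?thesis using N F_cases[OF xy(1)] F_cases[OF xy(2)] by linarith
      next
        case 2
        then have "F x = F y - 2 * N" using eq by simp
        then show ?thesis using N F_cases[OF xy(1)] F_cases[OF xy(2)] by linarith
      next
        case 3
        then have "2 * N * r \<ge> 2 * N * 2" using N by (intro mult_left_mono) auto
        then show ?thesis using eq N F_cases[OF xy(1)] F_cases[OF xy(2)] by linarith
      next
        case 4
        then have "2 * N * r \<le> 2 * N * (- 2)" using N by (intro mult_left_mono) auto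
        then show ?thesis using eq N F_cases[OF xy(1)] F_cases[OF xy(2)] by linarith
      qed
    qed
    then have "F x = F y" using eq by simp
    moreover have "(3::int) ^ k > 0" for k :: nat by simp
    then have "(3::int) ^ k \<noteq> - (3 ^ l)" "- ((3::int) ^ k) \<noteq> 3 ^ l" for k l :: nat
      by (smt (verit))+
    ultimately show "x = y"
      by (auto simp: F_def split: option.splits if_splits)
  qed
  have "(\<Sum>x\<in>I. C x * z x ^ j) = 0" if "j < card I" for j
  proof -
    define t where "t = pi / (3 ^ m - 1) * real j"
    have "j \<in> {..<3 ^ m - 1}" using that card by simp
    then have "a \<bullet> curve h m t = c" using sub unfolding t_def by blast
    then have c: "c = (\<Sum>k\<le>m. a $ h (2 * k) * cos (3 ^ k * t) + a $ h (Suc (2 * k)) * sin (3 ^ k * t))"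
      by (simp add: curve_def inner_sum_right inner_add_right inner_axis mult.commute)
    have z_pow: "z x ^ j = cis (of_int (F x) * t)" for x
    proof -
      have "z x ^ j = cis (real j * (pi / of_int N * of_int (F x)))"
        unfolding z_def by (rule Complex.DeMoivre)
      also have "real j * (pi / of_int N * of_int (F x)) = of_int (F x) * t"
        by (simp add: t_def N_def)
      finally show ?thesis .
    qed
    have total: "(\<Sum>x\<in>I. C x * z x ^ j) = - complex_of_real c +
        (\<Sum>k\<le>m. \<Sum>b\<in>UNIV. C (Some (k, b)) * z (Some (k, b)) ^ j)"
    proof -
      have "(\<Sum>x\<in>Some ` ({..m} \<times> UNIV). C x * z x ^ j) =
          (\<Sum>k\<le>m. \<Sum>b\<in>UNIV. C (Some (k, b)) * z (Some (k, b)) ^ j)"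
        unfolding sum.cartesian_product by (subst sum.reindex) (auto intro: sum.cong)
      moreover have "C None * z None ^ j = - complex_of_real c"
        by (simp add: C_def z_def F_def)
      ultimately show ?thesis
        unfolding I_def by (subst sum.insert) auto
    qed
    have "(\<Sum>b\<in>UNIV. C (Some (k, b)) * z (Some (k, b)) ^ j) =
        complex_of_real (a $ h (2 * k) * cos (3 ^ k * t) + a $ h (Suc (2 * k)) * sin (3 ^ k * t))" for k
      unfolding UNIV_bool z_pow by (simp add: C_def F_def w_def complex_eq_iff) (simp add: field_simps)
    then show ?thesis unfolding total c by simp
  qed
  then have "C (Some (k, True)) = 0" if "k \<le> m" for k
    using vandermonde_kernel_trivial[OF \<open>finite I\<close> \<open>inj_on z I\<close>] that by (simp add: I_def)
  then have w: "w k = 0" if "k \<le> m" for k using that by (simp add: C_def)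
  have "a $ h q = 0" if "q < 2 * (m + 1)" for q
  proof (cases "even q")
    case True
    then show ?thesis using w[of "q div 2"] that by (auto simp: w_def complex_eq_iff)
  next
    case False
    then show ?thesis using w[of "q div 2"] that by (auto simp: w_def complex_eq_iff)
  qed
  \<comment> \<open>In exact dimension \<open>2 * (m + 1)\<close> the map \<open>h\<close> reaches
    every coordinate, so all of \<open>a\<close> vanishes.\<close>
  moreover have "h ` {..<2 * (m + 1)} = UNIV"
    using inj dim by (intro card_subset_eq) (auto simp: card_image)
  ultimately have "a = 0" unfolding vec_eq_iff by (metis UNIV_I imageE lessThan_iff zero_index)
  with \<open>a \<noteq> 0\<close> show False ..
qed

section \<open>Extremal sets and lower bounds on the maxima\<close>

lemma exists_strictly_antipodal_set:
  assumes "2 * (m + 1) \<le> CARD('n::finite)"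
  obtains X :: "(real ^ 'n::finite) set" where "finite X" "card X = 3 ^ m - 1"
    "pairwise (strictly_antipodal X) X"
    "m \<ge> 2 \<Longrightarrow> CARD('n) = 2 * (m + 1) \<Longrightarrow> affine hull X = UNIV"
proof -
  obtain h :: "nat \<Rightarrow> 'n" where inj: "inj_on h {..<2 * (m + 1)}"
    using assms by (rule exists_inj_on_lessThan)
  let ?A = "{..<3 ^ m - 1} \<times> {..<1::nat}"
  let ?X = "(\<lambda>a. curve h m (angle m 1 a)) ` ?A"
  note conf = clustered_configuration[OF inj subset_refl[of ?A]]
  show thesis
  proof
    show "finite ?X" by simp
    show "card ?X = 3 ^ m - 1" using card_image[OF conf(1)] by (simp add: card_cartesian_product)
    show "pairwise (strictly_antipodal ?X) ?X"
    proof (intro pairwiseI)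
      fix x y assume "x \<in> ?X" "y \<in> ?X" "x \<noteq> y"
      then obtain a b where ab: "a \<in> ?A" "b \<in> ?A" "x = curve h m (angle m 1 a)"
        "y = curve h m (angle m 1 b)" by blast
      \<comment> \<open>Clusters are singletons here, so distinct points lie in distinct
        clusters.\<close>
      with \<open>x \<noteq> y\<close> have "fst a \<noteq> fst b" by auto
      with conf(2) ab show "strictly_antipodal ?X x y" by blast
    qed
    have "?X = (\<lambda>j. curve h m (pi / (3 ^ m - 1) * real j)) ` {..<3 ^ m - 1}"
      by (force simp: angle_def image_iff)
    then show "affine hull ?X = UNIV" if "m \<ge> 2" "CARD('n) = 2 * (m + 1)"
      using affine_hull_curve[OF inj that(2,1)] by simp
  qed
qed

lemma max_num_strictly_antipodal_ge:
  fixes Y :: "(real ^ 'n::finite) set"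
  assumes "finite Y" "card Y = n"
  shows "num_strictly_antipodal Y \<le> max_num_strictly_antipodal TYPE('n) n"
  unfolding max_num_strictly_antipodal_def
proof (rule Max_ge)
  \<comment> \<open>A crude bound by the number of subsets suffices for the finiteness that
    \<open>Max\<close> requires.\<close>
  have "num_strictly_antipodal Z \<le> 2 ^ n" if "finite Z" "card Z = n" for Z :: "(real ^ 'n) set"
  proof -
    have "num_strictly_antipodal Z \<le> card (Pow Z)"
      unfolding num_strictly_antipodal_def
      using strictly_antipodal_pairs_subset that(1) by (intro card_mono) simp_all
    then show ?thesis using that by (simp add: card_Pow)
  qed
  then have "{num_strictly_antipodal Y | Y :: (real ^ 'n) set. finite Y \<and> card Y = n} \<subseteq> {..2 ^ n}"
    by blast
  then show "finite {num_strictly_antipodal Y | Y :: (real ^ 'n) set. finite Y \<and> card Y = n}"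
    by (rule finite_subset) simp
qed (use assms in blast)

text \<open>Use \<open>s = n div N\<close> points in each full cluster. Replacing
  \<open>s * N\<close> by \<open>n\<close> costs at most \<open>2 * N * n\<close> in the square,
  hence at most \<open>N * n\<close> after the factor \<open>\<gamma> / 2\<close>, and
  \<open>N \<le> 3 ^ m\<close>.\<close>

lemma max_num_strictly_antipodal_lower_bound:
  assumes "m \<ge> 1" "2 * (m + 1) \<le> CARD('n::finite)"
  shows "(1 - 1 / (3 ^ m - 1)) * ((real n)\<^sup>2 / 2) - 3 ^ m * real n
    \<le> real (max_num_strictly_antipodal TYPE('n::finite) n)"
proof -
  define N :: nat where "N = 3 ^ m - 1"
  define s where "s = n div N"
  have "(3::nat) ^ 1 \<le> 3 ^ m" using assms(1) by (intro power_increasing) auto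
  then have N: "N \<ge> 2" "real N = 3 ^ m - 1" by (simp_all add: N_def of_nat_diff)
  have "s * N \<le> n" "n \<le> Suc s * N"
    using N dividend_less_div_times[of N n] by (simp_all add: s_def add.commute)
  then obtain Y :: "(real ^ 'n) set" where Y: "finite Y" "card Y = n"
    "(real s)\<^sup>2 * ((3 ^ m - 1) * (3 ^ m - 2) / 2) \<le> real (num_strictly_antipodal Y)"
    using exists_many_strictly_antipodal_pairs[OF assms(2)] unfolding N_def by metis
  have "real n \<le> real (Suc s * N)" using \<open>n \<le> Suc s * N\<close> of_nat_le_iff by blast
  then have sN: "real n - real N \<le> real s * real N" by (simp add: algebra_simps)
  \<comment> \<open>Squaring \<open>sN\<close> is legitimate only for \<open>n \<ge> N\<close>; for
    \<open>n < N\<close> the left-hand side is nonpositive.\<close>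
  have sq: "(real n)\<^sup>2 - 2 * real N * real n \<le> (real s * real N)\<^sup>2"
  proof (cases "real n \<ge> real N")
    case True
    then have "(real n - real N)\<^sup>2 \<le> (real s * real N)\<^sup>2"
      using sN by (intro power_mono) auto
    moreover have "0 \<le> (real N)\<^sup>2" by simp
    ultimately show ?thesis unfolding power2_diff by (simp only: mult.commute mult.left_commute)
  next
    case False
    have "(real n)\<^sup>2 - 2 * real N * real n = real n * (real n - 2 * real N)"
      by (simp add: algebra_simps power2_eq_square)
    also have "\<dots> \<le> 0" using False by (intro mult_nonneg_nonpos) auto
    finally show ?thesis by (smt (verit) zero_le_power2)
  qed
  define \<gamma> where "\<gamma> = 1 - 1 / real N"
  have \<gamma>: "0 \<le> \<gamma>" "\<gamma> \<le> 1" using N by (simp_all add: \<gamma>_def)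
  have "\<gamma> * ((real n)\<^sup>2 / 2) - 3 ^ m * real n \<le> \<gamma> * ((real n)\<^sup>2 / 2) - real N * real n"
    using N by (simp add: mult_right_mono)
  also have "\<dots> \<le> \<gamma> * ((real n)\<^sup>2 / 2) - \<gamma> * (real N * real n)"
    using mult_right_mono[OF \<gamma>(2), of "real N * real n"] by simp
  also have "\<dots> = \<gamma> * (((real n)\<^sup>2 - 2 * real N * real n) / 2)"
    by (simp add: algebra_simps)
  also have "\<dots> \<le> \<gamma> * ((real s * real N)\<^sup>2 / 2)"
    using sq \<gamma>(1) by (intro mult_left_mono) auto
  also have "\<dots> = (real s)\<^sup>2 * (real N * (real N - 1) / 2)"
    using N(1) by (simp add: \<gamma>_def field_simps power2_eq_square)
  also have "\<dots> \<le> real (num_strictly_antipodal Y)" using Y(3) by (simp add: N(2))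
  also have "\<dots> \<le> real (max_num_strictly_antipodal TYPE('n) n)"
    using max_num_strictly_antipodal_ge[OF Y(1,2)] by simp
  finally show ?thesis unfolding \<gamma>_def N(2) .
qed

lemma nat_floor_half_diff_one:
  assumes "d \<ge> 4"
  shows "1 \<le> nat \<lfloor>real d / 2 - 1\<rfloor>" and "2 * (nat \<lfloor>real d / 2 - 1\<rfloor> + 1) \<le> d"
proof -
  have "\<lfloor>real d / 2\<rfloor> = int (d div 2)"
    using floor_divide_of_nat_eq[of d 2] by simp
  then have "\<lfloor>real d / 2 - 1\<rfloor> = int (d div 2) - 1" by simp
  then have half: "nat \<lfloor>real d / 2 - 1\<rfloor> = d div 2 - 1" by simp
  show "1 \<le> nat \<lfloor>real d / 2 - 1\<rfloor>" unfolding half using assms by presburger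
  show "2 * (nat \<lfloor>real d / 2 - 1\<rfloor> + 1) \<le> d" unfolding half using assms by presburger
qed

theorem theorem4p1:
  shows
    "(\<forall>m::nat. m \<ge> 1 \<and> CARD('n::finite) = 2 * (m + 1) \<longrightarrow>
       (\<exists>X :: (real ^ 'n) set. finite X \<and> card X = 3 ^ m - 1 \<and>
          (m \<ge> 2 \<longrightarrow> affine hull X = UNIV) \<and>
          pairwise (strictly_antipodal X) X)) \<and>
     (CARD('n) \<ge> 4 \<longrightarrow>
       max_strictly_antipodal_set TYPE('n) \<ge> enat (3 ^ nat \<lfloor>real CARD('n) / 2 - 1\<rfloor> - 1)) \<and>
     (\<forall>(m::nat) (s::nat) (n::nat).
       m \<ge> 1 \<and> s \<ge> 1 \<and> CARD('n) = 2 * (m + 1) \<and> n = s * (3 ^ m - 1) \<longrightarrow>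
       (\<exists>Y :: (real ^ 'n) set. finite Y \<and> card Y = n \<and>
          real (num_strictly_antipodal Y) \<ge> (1 - 1 / (3 ^ m - 1)) * ((real n)\<^sup>2 / 2))) \<and>
     (CARD('n) \<ge> 4 \<longrightarrow>
       (\<exists>C::real. \<forall>n::nat.
          real (max_num_strictly_antipodal TYPE('n) n) \<ge>
            (1 - 1 / (3 ^ nat \<lfloor>real CARD('n) / 2 - 1\<rfloor> - 1)) * ((real n)\<^sup>2 / 2) - C * real n))"
proof (intro conjI allI impI)
  fix m :: nat assume m: "m \<ge> 1 \<and> CARD('n) = 2 * (m + 1)"
  then have "2 * (m + 1) \<le> CARD('n)" by simp
  then show "\<exists>X :: (real ^ 'n) set. finite X \<and> card X = 3 ^ m - 1 \<and>
      (m \<ge> 2 \<longrightarrow> affine hull X = UNIV) \<and> pairwise (strictly_antipodal X) X"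
    using exists_strictly_antipodal_set m by metis
next
  assume "CARD('n) \<ge> 4"
  define m where "m = nat \<lfloor>real CARD('n) / 2 - 1\<rfloor>"
  have "2 * (m + 1) \<le> CARD('n)" using nat_floor_half_diff_one[OF \<open>CARD('n) \<ge> 4\<close>] unfolding m_def by blast+
  then obtain X :: "(real ^ 'n) set" where X: "finite X" "card X = 3 ^ m - 1"
    "pairwise (strictly_antipodal X) X"
    using exists_strictly_antipodal_set by metis
  then have "enat (card X) \<le> max_strictly_antipodal_set TYPE('n)"
    unfolding max_strictly_antipodal_set_def by (intro SUP_upper) auto
  then show "enat (3 ^ nat \<lfloor>real CARD('n) / 2 - 1\<rfloor> - 1) \<le> max_strictly_antipodal_set TYPE('n)"
    by (simp add: X(2) m_def)
next
  fix m s n :: nat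
  assume asm: "m \<ge> 1 \<and> s \<ge> 1 \<and> CARD('n) = 2 * (m + 1) \<and> n = s * (3 ^ m - 1)"
  then have "2 * (m + 1) \<le> CARD('n)" "s * (3 ^ m - 1) \<le> n" "n \<le> Suc s * (3 ^ m - 1)" by auto
  then obtain Y :: "(real ^ 'n) set" where Y: "finite Y" "card Y = n"
    "(real s)\<^sup>2 * ((3 ^ m - 1) * (3 ^ m - 2) / 2) \<le> real (num_strictly_antipodal Y)"
    by (rule exists_many_strictly_antipodal_pairs)
  have "(3::real) ^ 1 \<le> 3 ^ m" using asm by (intro power_increasing) auto
  \<comment> \<open>For \<open>n = s * (3 ^ m - 1)\<close> the claimed bound is exactly the number
    of pairs from distinct clusters.\<close>
  then have "(1 - 1 / (3 ^ m - 1)) * ((real n)\<^sup>2 / 2) = (real s)\<^sup>2 * ((3 ^ m - 1) * (3 ^ m - 2) / 2)"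
    using asm by (simp add: of_nat_diff field_simps power2_eq_square)
  with Y show "\<exists>Y :: (real ^ 'n) set. finite Y \<and> card Y = n \<and>
      real (num_strictly_antipodal Y) \<ge> (1 - 1 / (3 ^ m - 1)) * ((real n)\<^sup>2 / 2)"
    by auto
next
  assume "CARD('n) \<ge> 4"
  define m where "m = nat \<lfloor>real CARD('n) / 2 - 1\<rfloor>"
  have "m \<ge> 1" "2 * (m + 1) \<le> CARD('n)" using nat_floor_half_diff_one[OF \<open>CARD('n) \<ge> 4\<close>] unfolding m_def by blast+
  then show "\<exists>C::real. \<forall>n::nat.
      real (max_num_strictly_antipodal TYPE('n) n) \<ge>
        (1 - 1 / (3 ^ nat \<lfloor>real CARD('n) / 2 - 1\<rfloor> - 1)) * ((real n)\<^sup>2 / 2) - C * real n"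
    using max_num_strictly_antipodal_lower_bound unfolding m_def by blast
qed

end
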